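(* Let $\Bbbk$ be a field of characteristic zero. (1) For every (not necessarily associative or commutative) $\Bbbk$-algebra $A$ satisfying the identity $w_4=0$, the associative algebra $L(A)$ generated by all left multiplications $l_a\colon x\mapsto ax$ ($a\in A$) and the associative algebra $R(A)$ generated by all right multiplications $r_a\colon x\mapsto xa$ ($a\in A$) are nilpotent of index $7$, that is, $L(A)^7=0$ and $R(A)^7=0$. Moreover, the index $7$ cannot be lowered in general: there exists an algebra $A$ satisfying $w_4=0$ with $L(A)^6\neq 0$, and there exists an algebra $A$ satisfying $w_4=0$ with $R(A)^6\ne 0$. (2) In general, the algebra $U(A)$ generated by both left and right multiplications is not nilpotent: there exists an algebra $A$ satisfying the identity $w_4=0$ such that $U(A)^N\neq 0$ for all $N\ge 1$.
   Context: An algebra is a $\Bbbk$-vector space $A$ with a bilinear product $A\otimes A\to A$, $(a,b)\mapsto ab$, with no associativity, commutativity or unit assumed. The multilinear operation $w_n(a_1,\ldots,a_n)$ is the sum of all $\frac1n\binom{2n-2}{n-1}$ bracketings of the product $a_1a_2\cdots a_n$ (arguments in this order); equivalently $w_1(a_1)=a_1$ and $w_n(a_1,\ldots,a_n)=\sum_{i=1}^{n-1}w_i(a_1,\ldots,a_i)\,w_{n-i}(a_{i+1},\ldots,a_n)$. Thus $w_4(a_1,a_2,a_3,a_4)=((a_1a_2)a_3)a_4+(a_1(a_2a_3))a_4+(a_1a_2)(a_3a_4)+a_1((a_2a_3)a_4)+a_1(a_2(a_3a_4))$. "$A$ satisfies $w_n=0$" means that $w_n$ vanishes for all arguments from $A$.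 $L(A)$, $R(A)$, $U(A)$ denote the (non-unital) associative subalgebras of $\operatorname{End}_{\Bbbk}(A)$ generated respectively by all $l_a$, by all $r_a$, and by all $l_a$ and $r_a$ together. For a non-unital associative algebra $B$, $B^N$ is the span of all products of $N$ elements of $B$; $B$ is nilpotent if $B^N=0$ for some $N$, and nilpotent of index $N$ if $B^N=0$. *)

theory Defs
  imports "HOL-Computational_Algebra.Polynomial" "HOL-Library.Function_Algebras"
begin

locale nonassoc_algebra = vector_space scale
  for scale :: "'k::field \<Rightarrow> 'a::ab_group_add \<Rightarrow> 'a" +
  fixes mul :: "'a \<Rightarrow> 'a \<Rightarrow> 'a"
  assumes linear_right: "Vector_Spaces.linear scale scale (\<lambda>b. mul a b)"
    and linear_left: "Vector_Spaces.linear scale scale (\<lambda>a. mul a b)"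

(* w_n(a_1,...,a_n) is w_op mul [a_1,...,a_n]; the value on the empty list is a dummy 0. *)
function w_op :: "('a::ab_group_add \<Rightarrow> 'a \<Rightarrow> 'a) \<Rightarrow> 'a list \<Rightarrow> 'a" where
  "w_op mul [] = 0"
| "w_op mul [a] = a"
| "w_op mul (a # b # as) =
    (\<Sum>i\<in>{1..<length (a # b # as)}.
       mul (w_op mul (take i (a # b # as))) (w_op mul (drop i (a # b # as))))"
  by pat_completeness auto
termination by (relation "measure (\<lambda>(_, as). length as)") auto

definition satisfies_w :: "('a::ab_group_add \<Rightarrow> 'a \<Rightarrow> 'a) \<Rightarrow> nat \<Rightarrow> bool" where
  "satisfies_w mul n \<longleftrightarrow> (\<forall>as. length as = n \<longrightarrow> w_op mul as = 0)"

definition End_alg :: "('k::field \<Rightarrow> 'a::ab_group_add \<Rightarrow> 'a) \<Rightarrow> ('a \<Rightarrow> 'a) set" where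
  "End_alg scale = {f. Vector_Spaces.linear scale scale f}"

definition fun_scale :: "('k::field \<Rightarrow> 'a::ab_group_add \<Rightarrow> 'a) \<Rightarrow> 'k \<Rightarrow> ('a \<Rightarrow> 'a) \<Rightarrow> ('a \<Rightarrow> 'a)" where
  "fun_scale scale c f = (\<lambda>x. scale c (f x))"

(* Non-unital: the identity map need not belong to B. *)
definition end_subalgebra :: "('k::field \<Rightarrow> 'a::ab_group_add \<Rightarrow> 'a) \<Rightarrow> ('a \<Rightarrow> 'a) set \<Rightarrow> bool" where
  "end_subalgebra scale B \<longleftrightarrow>
     B \<subseteq> End_alg scale \<and> module.subspace (fun_scale scale) B \<and> (\<forall>f\<in>B. \<forall>g\<in>B. f \<circ> g \<in> B)"

definition L_alg :: "('k::field \<Rightarrow> 'a::ab_group_add \<Rightarrow> 'a) \<Rightarrow> ('a \<Rightarrow> 'a \<Rightarrow> 'a) \<Rightarrow> ('a \<Rightarrow> 'a) set" where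
  "L_alg scale mul = end_subalgebra scale hull range (\<lambda>a x. mul a x)"

definition R_alg :: "('k::field \<Rightarrow> 'a::ab_group_add \<Rightarrow> 'a) \<Rightarrow> ('a \<Rightarrow> 'a \<Rightarrow> 'a) \<Rightarrow> ('a \<Rightarrow> 'a) set" where
  "R_alg scale mul = end_subalgebra scale hull range (\<lambda>a x. mul x a)"

definition U_alg :: "('k::field \<Rightarrow> 'a::ab_group_add \<Rightarrow> 'a) \<Rightarrow> ('a \<Rightarrow> 'a \<Rightarrow> 'a) \<Rightarrow> ('a \<Rightarrow> 'a) set" where
  "U_alg scale mul =
     end_subalgebra scale hull (range (\<lambda>a x. mul a x) \<union> range (\<lambda>a x. mul x a))"

(* The power B^N, meaningful for N >= 1 (for N = 0 the empty product is the identity map). *)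
definition end_power :: "('k::field \<Rightarrow> 'a::ab_group_add \<Rightarrow> 'a) \<Rightarrow> ('a \<Rightarrow> 'a) set \<Rightarrow> nat \<Rightarrow> ('a \<Rightarrow> 'a) set" where
  "end_power scale B N =
     module.span (fun_scale scale) {foldr (\<circ>) fs id | fs. length fs = N \<and> set fs \<subseteq> B}"

lemma w_op_4:
  assumes "nonassoc_algebra scale mul"
  shows "w_op mul [a, b, c, d] =
    mul (mul (mul a b) c) d + mul (mul a (mul b c)) d + mul (mul a b) (mul c d)
    + mul a (mul (mul b c) d) + mul a (mul b (mul c d))"
proof -
  interpret nonassoc_algebra scale mul by fact
  have "mul (x + y) z = mul x z + mul y z" "mul z (x + y) = mul z x + mul z y" for x y z
    by (rule module_hom.add[OF Vector_Spaces.linear.axioms(3)[OF linear_left]],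
        rule module_hom.add[OF Vector_Spaces.linear.axioms(3)[OF linear_right]])
  then show ?thesis
    by (simp add: numeral_eq_Suc atLeastLessThanSuc)
qed

lemma vector_space_fun_scale:
  assumes "vector_space scale"
  shows "vector_space (fun_scale scale)"
proof -
  interpret vector_space scale by fact
  show ?thesis
    by standard (auto simp: fun_scale_def fun_eq_iff scale_right_distrib scale_left_distrib)
qed

(* The existence claims are stated for algebras whose underlying additive group is that of
   'k poly, with arbitrary scalar action and product. This loses nothing: each is witnessed
   by an algebra iff it is witnessed by a countably generated, hence countable-dimensional,
   subalgebra, which after adding a zero-product summand is isomorphic to 'k poly as a
   vector space. *)

end

(* The identity a1 (a2 (... (a7 x))) = 0 is a linear consequence of w4 = 0 among the 429
   bracketings of eight letters. It is reached through shorter identities: in arity five and six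
   the ideal generated by w4 contains four-term relations such as
     a (b (c (d e))) - (a b) ((c d) e) = (a (b c)) (d e) - (((a b) c) d) e,
   in arity seven these combine to equalities between single bracketings, and in arity eight such
   equalities and a few four-term relations leave no room for the right comb. All these relations
   were found by linear algebra over the rationals.
   Right multiplications are handled by passing to the opposite algebra.

   For sharpness, take the free one-generated algebra with w4 = 0, cut off above degree seven, and
   divide by the largest ideal in the kernel of a functional of degree seven that is nonzero on the
   right comb.

   For U(A), let a generator e with e e = 0 act on a bimodule M with M M = 0. Then w4 = 0 says that
   every combination of the left and right action of e has cube zero, and this holds for the pencil
   x (e12 - e23) + y (e21 + e32) of nilpotent matrices, while (e12 - e23) (e21 + e32) = e11 - e22
   is not nilpotent. *)
theory Submission
  imports Defs
begin

section \<open>Algebras and their multiplication algebras\<close>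

context nonassoc_algebra
begin

lemma mul_add_left: "mul (x + y) z = mul x z + mul y z"
  by (rule module_hom.add[OF Vector_Spaces.linear.axioms(3)[OF linear_left]])

lemma mul_add_right: "mul x (y + z) = mul x y + mul x z"
  by (rule module_hom.add[OF Vector_Spaces.linear.axioms(3)[OF linear_right]])

lemma mul_scale_left: "mul (scale c x) y = scale c (mul x y)"
  by (rule module_hom.scale[OF Vector_Spaces.linear.axioms(3)[OF linear_left]])

lemma mul_scale_right: "mul x (scale c y) = scale c (mul x y)"
  by (rule module_hom.scale[OF Vector_Spaces.linear.axioms(3)[OF linear_right]])

lemma mul_zero_right: "mul x 0 = 0"
  using mul_add_right[of x 0 0] by simp

lemma mul_zero_left: "mul 0 x = 0"
  using mul_add_left[of 0 0 x] by simp

lemma opposite: "nonassoc_algebra scale (\<lambda>x y. mul y x)"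
  by unfold_locales
    (simp_all add: mul_add_left mul_add_right mul_scale_left mul_scale_right)

lemma L_alg_opposite: "L_alg scale (\<lambda>x y. mul y x) = R_alg scale mul"
  by (simp add: L_alg_def R_alg_def)

lemma satisfies_w4_iff:
  "satisfies_w mul 4 \<longleftrightarrow> (\<forall>a b c d.
    mul (mul (mul a b) c) d + mul (mul a (mul b c)) d + mul (mul a b) (mul c d)
    + mul a (mul (mul b c) d) + mul a (mul b (mul c d)) = 0)"
proof -
  have "satisfies_w mul 4 \<longleftrightarrow> (\<forall>a b c d. w_op mul [a, b, c, d] = 0)"
  proof
    assume *: "\<forall>a b c d. w_op mul [a, b, c, d] = 0"
    show "satisfies_w mul 4"
      unfolding satisfies_w_def
    proof (intro allI impI)
      fix as :: "'a list"
      assume "length as = 4"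
      then obtain a b c d where "as = [a, b, c, d]"
        by (auto simp: length_Suc_conv eval_nat_numeral)
      with * show "w_op mul as = 0"
        by blast
    qed
  qed (simp add: satisfies_w_def del: w_op.simps)
  then show ?thesis
    by (simp only: w_op_4[OF nonassoc_algebra_axioms])
qed

end

text \<open>Reversing the word a b c d exchanges ((ab)c)d with a(b(cd)) and (a(bc))d with a((bc)d),
  and fixes (ab)(cd). So the sum over all five bracketings is preserved.\<close>

lemma satisfies_w4_opposite:
  assumes "nonassoc_algebra scale mul" "satisfies_w mul 4"
  shows "satisfies_w (\<lambda>x y. mul y x) 4"
proof -
  interpret nonassoc_algebra scale mul by fact
  interpret opp: nonassoc_algebra scale "\<lambda>x y. mul y x" by (rule opposite)
  show ?thesis
    using assms(2) unfolding opp.satisfies_w4_iff satisfies_w4_iff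
    by (simp add: add_ac)
qed

lemma hull_end_subalgebra_superset:
  assumes "f \<in> S"
  shows "f \<in> end_subalgebra scale hull S"
  using assms hull_subset[of S] by blast

lemma foldr_comp_Cons: "foldr (\<circ>) (f # fs) id x = f (foldr (\<circ>) fs id x)"
  by simp

section \<open>The ascending annihilator series and the nilpotency of L(A)\<close>

fun iterated_annihilator :: "('a::zero \<Rightarrow> 'a \<Rightarrow> 'a) \<Rightarrow> nat \<Rightarrow> 'a set" where
  "iterated_annihilator mul 0 = {0}"
| "iterated_annihilator mul (Suc n) = {x. \<forall>a. mul a x \<in> iterated_annihilator mul n}"

context nonassoc_algebra
begin

lemma subspace_iterated_annihilator: "subspace (iterated_annihilator mul n)"
  by (induction n)
    (auto simp: subspace_def mul_zero_right mul_add_right mul_scale_right)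

lemma iterated_annihilator_Suc:
  "iterated_annihilator mul n \<subseteq> iterated_annihilator mul (Suc n)"
  by (induction n) (auto simp: mul_zero_right)

text \<open>A hull is accessible only through its minimality. The endomorphisms that lower every
  step of the annihilator series by one form a subalgebra, and it contains all l_a by the very
  definition of the series.\<close>

lemma L_alg_lowers_annihilator:
  assumes "f \<in> L_alg scale mul" "x \<in> iterated_annihilator mul (Suc n)"
  shows "f x \<in> iterated_annihilator mul n"
proof -
  let ?B = "{f \<in> End_alg scale. \<forall>n. \<forall>x \<in> iterated_annihilator mul (Suc n).
    f x \<in> iterated_annihilator mul n}"
  interpret E: vector_space "fun_scale scale"
    by (rule vector_space_fun_scale) unfold_locales
  interpret P: vector_space_pair scale scale ..
  have "E.subspace ?B"
    unfolding E.subspace_def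
    by (auto simp: End_alg_def fun_scale_def[abs_def] zero_fun_def plus_fun_def P.linear_zero
        intro: P.linear_compose_add P.linear_compose_scale_right
          subspace_0[OF subspace_iterated_annihilator]
          subspace_add[OF subspace_iterated_annihilator]
          subspace_scale[OF subspace_iterated_annihilator]
        simp del: iterated_annihilator.simps)
  \<comment> \<open>A composite lowers the series by two steps; since the series is ascending, it
    also lowers it by one.\<close>
  moreover have "f \<circ> g \<in> ?B" if "f \<in> ?B" "g \<in> ?B" for f g
    using that iterated_annihilator_Suc
    by (auto simp: End_alg_def intro: Vector_Spaces.linear_compose simp del: iterated_annihilator.simps)
      blast
  ultimately have "end_subalgebra scale ?B"
    unfolding end_subalgebra_def by blast
  moreover have "range (\<lambda>a x. mul a x) \<subseteq> ?B"
    by (auto simp: End_alg_def linear_right)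
  ultimately have "L_alg scale mul \<subseteq> ?B"
    unfolding L_alg_def by (rule hull_minimal[rotated])
  with assms show ?thesis by blast
qed

text \<open>This reduces nilpotency of L(A) to combs of left multiplications: if n of them always
  kill a vector, so do n arbitrary elements of L(A).\<close>

lemma end_power_L_alg_eq_0:
  assumes "iterated_annihilator mul n = UNIV"
  shows "end_power scale (L_alg scale mul) n = {0}"
proof -
  interpret E: vector_space "fun_scale scale"
    by (rule vector_space_fun_scale) unfold_locales
  \<comment> \<open>The surplus k is needed for the induction: the inner factors stop one step above
    the target, and the outermost factor takes the last step.\<close>
  have "foldr (\<circ>) fs id x \<in> iterated_annihilator mul k"
    if "x \<in> iterated_annihilator mul (length fs + k)" "set fs \<subseteq> L_alg scale mul" for fs x k
    using that
  proof (induction fs arbitrary: k)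
    case (Cons f fs)
    from Cons.prems have "f \<in> L_alg scale mul" "x \<in> iterated_annihilator mul (length fs + Suc k)"
      "set fs \<subseteq> L_alg scale mul"
      by (simp_all del: iterated_annihilator.simps)
    then have "f (foldr (\<circ>) fs id x) \<in> iterated_annihilator mul k"
      by (rule L_alg_lowers_annihilator[OF _ Cons.IH])
    then show ?case
      by (simp only: foldr_comp_Cons)
  qed simp
  from this[where k = 0] assms
  have "foldr (\<circ>) fs id = 0" if "length fs = n" "set fs \<subseteq> L_alg scale mul" for fs
    using that by (intro ext) simp
  then have "{foldr (\<circ>) fs id | fs. length fs = n \<and> set fs \<subseteq> L_alg scale mul} \<subseteq> {0}"
    by blast
  then have "end_power scale (L_alg scale mul) n \<subseteq> E.span {0}"
    unfolding end_power_def by (rule E.span_mono)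
  moreover have "0 \<in> end_power scale (L_alg scale mul) n"
    unfolding end_power_def by (rule E.span_zero)
  ultimately show ?thesis
    by auto
qed

end

lemma end_power_nonzero:
  assumes "vector_space scale" "length fs = n" "set fs \<subseteq> B" "foldr (\<circ>) fs id x \<noteq> 0"
  shows "end_power scale B n \<noteq> {0}"
proof -
  interpret E: vector_space "fun_scale scale"
    by (rule vector_space_fun_scale) fact
  have "foldr (\<circ>) fs id \<in> end_power scale B n"
    unfolding end_power_def using assms by (intro E.span_base) blast
  moreover have "foldr (\<circ>) fs id \<noteq> 0"
    using assms(4) by (auto simp: zero_fun_def)
  ultimately show ?thesis by blast
qed

section \<open>Certificates for multilinear identities\<close>

datatype tree = Leaf nat | Node tree tree (infix "\<cdot>" 70)

text \<open>Integer coefficients keep the formal computations independent of the field. A tree may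
  occur several times in a list, so cancellation has to be decided by
  \<open>vanishes\<close>.\<close>

type_synonym lincomb = "(int \<times> tree) list"

abbreviation (input) x0 where "x0 \<equiv> Leaf 0"
abbreviation (input) x1 where "x1 \<equiv> Leaf 1"
abbreviation (input) x2 where "x2 \<equiv> Leaf 2"
abbreviation (input) x3 where "x3 \<equiv> Leaf 3"
abbreviation (input) x4 where "x4 \<equiv> Leaf 4"
abbreviation (input) x5 where "x5 \<equiv> Leaf 5"
abbreviation (input) x6 where "x6 \<equiv> Leaf 6"
abbreviation (input) x7 where "x7 \<equiv> Leaf 7"

primrec tree_subst :: "tree list \<Rightarrow> tree \<Rightarrow> tree" where
  "tree_subst ts (Leaf i) = ts ! i"
| "tree_subst ts (s \<cdot> t) = tree_subst ts s \<cdot> tree_subst ts t"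

text \<open>These are the ways to obtain new identities in the ideal generated by a given one: put
  products in place of letters, then multiply from either side.\<close>

datatype consequence =
  Inst lincomb "tree list"
| Left_mult tree consequence
| Right_mult consequence tree

text \<open>Recording the identity used separates two checks: that the trees cancel is pure
  computation, that the sources hold is a matter of earlier lemmas.\<close>

primrec source :: "consequence \<Rightarrow> lincomb" where
  "source (Inst p ts) = p"
| "source (Left_mult t q) = source q"
| "source (Right_mult q t) = source q"

primrec expand :: "consequence \<Rightarrow> lincomb" where
  "expand (Inst p ts) = map (map_prod id (tree_subst ts)) p"
| "expand (Left_mult t q) = map (map_prod id (\<lambda>s. t \<cdot> s)) (expand q)"
| "expand (Right_mult q t) = map (map_prod id (\<lambda>s. s \<cdot> t)) (expand q)"

definition lincomb_scale :: "int \<Rightarrow> lincomb \<Rightarrow> lincomb" where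
  "lincomb_scale c p = map (map_prod ((*) c) id) p"

fun vanishes :: "lincomb \<Rightarrow> bool" where
  "vanishes [] \<longleftrightarrow> True"
| "vanishes ((c, t) # p) \<longleftrightarrow>
    c + sum_list (map fst (filter (\<lambda>(d, s). s = t) p)) = 0 \<and> vanishes (filter (\<lambda>(d, s). s \<noteq> t) p)"

text \<open>The factor \<^term>\<open>k\<close> clears the denominators of the rational combination.\<close>

definition certifies :: "int \<Rightarrow> (int \<times> consequence) list \<Rightarrow> lincomb \<Rightarrow> bool" where
  "certifies k cert p \<longleftrightarrow> k \<noteq> 0 \<and>
    vanishes (lincomb_scale (- k) p @ concat (map (\<lambda>(c, q). lincomb_scale c (expand q)) cert))"

section \<open>Soundness of the certificates in algebras with w4 = 0\<close>

locale w4_algebra = nonassoc_algebra scale mul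
  for scale :: "'k::field_char_0 \<Rightarrow> 'a::ab_group_add \<Rightarrow> 'a" and mul +
  assumes satisfies_w4: "satisfies_w mul 4"
begin

primrec tree_value :: "(nat \<Rightarrow> 'a) \<Rightarrow> tree \<Rightarrow> 'a" where
  "tree_value v (Leaf i) = v i"
| "tree_value v (s \<cdot> t) = mul (tree_value v s) (tree_value v t)"

definition lincomb_value :: "(nat \<Rightarrow> 'a) \<Rightarrow> lincomb \<Rightarrow> 'a" where
  "lincomb_value v p = (\<Sum>(c, t)\<leftarrow>p. scale (of_int c) (tree_value v t))"

definition is_identity :: "lincomb \<Rightarrow> bool" where
  "is_identity p \<longleftrightarrow> (\<forall>v. lincomb_value v p = 0)"

lemma lincomb_value_simps [simp]:
  "lincomb_value v [] = 0"
  "lincomb_value v (ct # p) = scale (of_int (fst ct)) (tree_value v (snd ct)) + lincomb_value v p"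
  "lincomb_value v (p @ q) = lincomb_value v p + lincomb_value v q"
  by (simp_all add: lincomb_value_def case_prod_beta)

lemma lincomb_value_scale [simp]:
  "lincomb_value v (lincomb_scale c p) = scale (of_int c) (lincomb_value v p)"
  by (induction p) (auto simp: lincomb_scale_def scale_right_distrib)

lemma tree_value_subst: "tree_value v (tree_subst ts t) = tree_value (\<lambda>i. tree_value v (ts ! i)) t"
  by (induction t) simp_all

text \<open>An identity holds under every assignment, hence also under the one that sends each
  letter to the value of the tree put in its place. Outer multiplications preserve zero by
  bilinearity.\<close>

lemma lincomb_value_expand:
  assumes "is_identity (source q)"
  shows "lincomb_value v (expand q) = 0"
  using assms
proof (induction q)
  case (Inst p ts)
  have "lincomb_value v (map (map_prod id (tree_subst ts)) p) =
      lincomb_value (\<lambda>i. tree_value v (ts ! i)) p"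
    by (induction p) (auto simp: tree_value_subst)
  with Inst show ?case
    by (simp add: is_identity_def)
next
  case (Left_mult t q)
  have "lincomb_value v (map (map_prod id (\<lambda>s. t \<cdot> s)) p) =
      mul (tree_value v t) (lincomb_value v p)" for p
    by (induction p) (auto simp: mul_zero_right mul_add_right mul_scale_right)
  with Left_mult show ?case
    by (simp add: mul_zero_right)
next
  case (Right_mult q t)
  have "lincomb_value v (map (map_prod id (\<lambda>s. s \<cdot> t)) p) =
      mul (lincomb_value v p) (tree_value v t)" for p
    by (induction p) (auto simp: mul_zero_left mul_add_left mul_scale_left)
  with Right_mult show ?case
    by (simp add: mul_zero_left)
qed

lemma lincomb_value_filter:
  "lincomb_value v p = scale (of_int (sum_list (map fst (filter (\<lambda>(d, s). s = t) p)))) (tree_value v t)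
    + lincomb_value v (filter (\<lambda>(d, s). s \<noteq> t) p)"
  by (induction p) (auto simp: scale_left_distrib add_ac)

lemma vanishes_imp_lincomb_value_eq_0: "vanishes p \<Longrightarrow> lincomb_value v p = 0"
proof (induction p rule: vanishes.induct)
  case (2 c t p)
  have "lincomb_value v ((c, t) # p) =
      scale (of_int (c + sum_list (map fst (filter (\<lambda>(d, s). s = t) p)))) (tree_value v t)
      + lincomb_value v (filter (\<lambda>(d, s). s \<noteq> t) p)"
    by (simp only: lincomb_value_simps lincomb_value_filter[of v p t] fst_conv snd_conv
        of_int_add scale_left_distrib add.assoc)
  with 2 show ?case
    by simp
qed simp

text \<open>The certificate shows that k times p is formally a combination of consequences, each of
  value zero. In characteristic zero the nonzero integer k can be cancelled.\<close>

lemma is_identityI: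
  assumes "certifies k cert p" "list_all (\<lambda>(c, q). is_identity (source q)) cert"
  shows "is_identity p"
  unfolding is_identity_def
proof
  fix v
  have "lincomb_value v (concat (map (\<lambda>(c, q). lincomb_scale c (expand q)) cert)) = 0"
    using assms(2) by (induction cert) (auto simp: lincomb_value_expand)
  with assms(1) have "scale (of_int (- k)) (lincomb_value v p) = 0" "k \<noteq> 0"
    using vanishes_imp_lincomb_value_eq_0[of "lincomb_scale (- k) p @ _" v]
    by (auto simp: certifies_def)
  then show "lincomb_value v p = 0"
    by simp
qed

end

section \<open>The intermediate identities in arities five to eight\<close>

definition w4_identity :: lincomb where
  "w4_identity =
    [(1, ((x0 \<cdot> x1) \<cdot> x2) \<cdot> x3),
     (1, (x0 \<cdot> (x1 \<cdot> x2)) \<cdot> x3),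
     (1, (x0 \<cdot> x1) \<cdot> (x2 \<cdot> x3)),
     (1, x0 \<cdot> ((x1 \<cdot> x2) \<cdot> x3)),
     (1, x0 \<cdot> (x1 \<cdot> (x2 \<cdot> x3)))]"

text \<open>A bracketing of n letters is a triangulation of an (n+1)-gon, and
  \<open>w4_identity\<close> sums the triangulations of a pentagon, so its consequences are stable
  under rotation. For the hexagon put P = a(b(c(de))) - (ab)((cd)e), Q = a(((bc)d)e) - (a(b(cd)))e,
  R = (a(bc))(de) - (((ab)c)d)e, S = a((bc)(de)) - ((ab)(cd))e. The six identities of arity five are
  the six pairwise comparisons in P = Q = R = -S/2. P, Q and R are differences of opposite fans (a
  fan has all its diagonals at one vertex); S is the difference of the two triangulations with an
  inner triangle.\<close>

definition arity5_a :: lincomb where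
  "arity5_a =
    [(2, x0 \<cdot> (x1 \<cdot> (x2 \<cdot> (x3 \<cdot> x4)))),
     (1, x0 \<cdot> ((x1 \<cdot> x2) \<cdot> (x3 \<cdot> x4))),
     (-2, (x0 \<cdot> x1) \<cdot> ((x2 \<cdot> x3) \<cdot> x4)),
     (-1, ((x0 \<cdot> x1) \<cdot> (x2 \<cdot> x3)) \<cdot> x4)]"

definition arity5_b :: lincomb where
  "arity5_b =
    [(1, x0 \<cdot> (x1 \<cdot> (x2 \<cdot> (x3 \<cdot> x4)))),
     (-1, x0 \<cdot> (((x1 \<cdot> x2) \<cdot> x3) \<cdot> x4)),
     (-1, (x0 \<cdot> x1) \<cdot> ((x2 \<cdot> x3) \<cdot> x4)),
     (1, (x0 \<cdot> (x1 \<cdot> (x2 \<cdot> x3))) \<cdot> x4)]"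

definition arity5_c :: lincomb where
  "arity5_c =
    [(1, x0 \<cdot> (x1 \<cdot> (x2 \<cdot> (x3 \<cdot> x4)))),
     (-1, (x0 \<cdot> x1) \<cdot> ((x2 \<cdot> x3) \<cdot> x4)),
     (-1, (x0 \<cdot> (x1 \<cdot> x2)) \<cdot> (x3 \<cdot> x4)),
     (1, (((x0 \<cdot> x1) \<cdot> x2) \<cdot> x3) \<cdot> x4)]"

definition arity5_d :: lincomb where
  "arity5_d =
    [(1, x0 \<cdot> ((x1 \<cdot> x2) \<cdot> (x3 \<cdot> x4))),
     (2, x0 \<cdot> (((x1 \<cdot> x2) \<cdot> x3) \<cdot> x4)),
     (-2, (x0 \<cdot> (x1 \<cdot> (x2 \<cdot> x3))) \<cdot> x4),
     (-1, ((x0 \<cdot> x1) \<cdot> (x2 \<cdot> x3)) \<cdot> x4)]"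

definition arity5_e :: lincomb where
  "arity5_e =
    [(1, x0 \<cdot> ((x1 \<cdot> x2) \<cdot> (x3 \<cdot> x4))),
     (2, (x0 \<cdot> (x1 \<cdot> x2)) \<cdot> (x3 \<cdot> x4)),
     (-1, ((x0 \<cdot> x1) \<cdot> (x2 \<cdot> x3)) \<cdot> x4),
     (-2, (((x0 \<cdot> x1) \<cdot> x2) \<cdot> x3) \<cdot> x4)]"

definition arity5_f :: lincomb where
  "arity5_f =
    [(1, x0 \<cdot> (((x1 \<cdot> x2) \<cdot> x3) \<cdot> x4)),
     (-1, (x0 \<cdot> (x1 \<cdot> x2)) \<cdot> (x3 \<cdot> x4)),
     (-1, (x0 \<cdot> (x1 \<cdot> (x2 \<cdot> x3))) \<cdot> x4),
     (1, (((x0 \<cdot> x1) \<cdot> x2) \<cdot> x3) \<cdot> x4)]"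

text \<open>Up to sign the seven identities of arity six are the rotations of a single one for the
  heptagon: twice the sum of two fans equals the sum of two triangulations that are not fans. The
  fans are the terms with coefficient 2 or -2.\<close>

definition arity6_a :: lincomb where
  "arity6_a =
    [(2, x0 \<cdot> (x1 \<cdot> (x2 \<cdot> (x3 \<cdot> (x4 \<cdot> x5))))),
     (-1, (x0 \<cdot> x1) \<cdot> ((x2 \<cdot> x3) \<cdot> (x4 \<cdot> x5))),
     (2, (x0 \<cdot> (x1 \<cdot> x2)) \<cdot> ((x3 \<cdot> x4) \<cdot> x5)),
     (-1, (((x0 \<cdot> x1) \<cdot> x2) \<cdot> (x3 \<cdot> x4)) \<cdot> x5)]"

definition arity6_b :: lincomb where
  "arity6_b =
    [(2, x0 \<cdot> (x1 \<cdot> (x2 \<cdot> (x3 \<cdot> (x4 \<cdot> x5))))),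
     (-1, x0 \<cdot> ((x1 \<cdot> x2) \<cdot> ((x3 \<cdot> x4) \<cdot> x5))),
     (2, (x0 \<cdot> x1) \<cdot> (((x2 \<cdot> x3) \<cdot> x4) \<cdot> x5)),
     (-1, ((x0 \<cdot> x1) \<cdot> (x2 \<cdot> (x3 \<cdot> x4))) \<cdot> x5)]"

definition arity6_c :: lincomb where
  "arity6_c =
    [(1, x0 \<cdot> (x1 \<cdot> ((x2 \<cdot> x3) \<cdot> (x4 \<cdot> x5)))),
     (1, x0 \<cdot> (((x1 \<cdot> x2) \<cdot> (x3 \<cdot> x4)) \<cdot> x5)),
     (-2, (x0 \<cdot> x1) \<cdot> (((x2 \<cdot> x3) \<cdot> x4) \<cdot> x5)),
     (-2, (x0 \<cdot> (x1 \<cdot> (x2 \<cdot> (x3 \<cdot> x4)))) \<cdot> x5)]"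

definition arity6_d :: lincomb where
  "arity6_d =
    [(1, x0 \<cdot> ((x1 \<cdot> x2) \<cdot> (x3 \<cdot> (x4 \<cdot> x5)))),
     (-2, (x0 \<cdot> (x1 \<cdot> x2)) \<cdot> ((x3 \<cdot> x4) \<cdot> x5)),
     (1, ((x0 \<cdot> x1) \<cdot> (x2 \<cdot> x3)) \<cdot> (x4 \<cdot> x5)),
     (-2, ((((x0 \<cdot> x1) \<cdot> x2) \<cdot> x3) \<cdot> x4) \<cdot> x5)]"

definition arity6_e :: lincomb where
  "arity6_e =
    [(1, x0 \<cdot> ((x1 \<cdot> (x2 \<cdot> x3)) \<cdot> (x4 \<cdot> x5))),
     (-2, x0 \<cdot> ((((x1 \<cdot> x2) \<cdot> x3) \<cdot> x4) \<cdot> x5)),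
     (-2, (x0 \<cdot> (x1 \<cdot> (x2 \<cdot> (x3 \<cdot> x4)))) \<cdot> x5),
     (1, ((x0 \<cdot> x1) \<cdot> ((x2 \<cdot> x3) \<cdot> x4)) \<cdot> x5)]"

definition arity6_f :: lincomb where
  "arity6_f =
    [(1, x0 \<cdot> (((x1 \<cdot> x2) \<cdot> x3) \<cdot> (x4 \<cdot> x5))),
     (-2, (x0 \<cdot> (x1 \<cdot> (x2 \<cdot> x3))) \<cdot> (x4 \<cdot> x5)),
     (1, ((x0 \<cdot> (x1 \<cdot> x2)) \<cdot> (x3 \<cdot> x4)) \<cdot> x5),
     (-2, ((((x0 \<cdot> x1) \<cdot> x2) \<cdot> x3) \<cdot> x4) \<cdot> x5)]"

definition arity6_g :: lincomb where
  "arity6_g =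
    [(2, x0 \<cdot> ((((x1 \<cdot> x2) \<cdot> x3) \<cdot> x4) \<cdot> x5)),
     (2, (x0 \<cdot> (x1 \<cdot> (x2 \<cdot> x3))) \<cdot> (x4 \<cdot> x5)),
     (-1, (x0 \<cdot> ((x1 \<cdot> x2) \<cdot> (x3 \<cdot> x4))) \<cdot> x5),
     (-1, (((x0 \<cdot> x1) \<cdot> (x2 \<cdot> x3)) \<cdot> x4) \<cdot> x5)]"

text \<open>Each of the six identities of arity seven equates a triangulation of the octagon with
  its half-turn. In \<open>arity7_a\<close> and \<open>arity7_d\<close> these are opposite
  fans.\<close>

definition arity7_a :: lincomb where
  "arity7_a =
    [(1, (x0 \<cdot> (x1 \<cdot> x2)) \<cdot> (((x3 \<cdot> x4) \<cdot> x5) \<cdot> x6)),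
     (-1, x0 \<cdot> (x1 \<cdot> (x2 \<cdot> (x3 \<cdot> (x4 \<cdot> (x5 \<cdot> x6))))))]"

definition arity7_b :: lincomb where
  "arity7_b =
    [(1, ((x0 \<cdot> (x1 \<cdot> x2)) \<cdot> ((x3 \<cdot> x4) \<cdot> x5)) \<cdot> x6),
     (-1, x0 \<cdot> (x1 \<cdot> ((x2 \<cdot> x3) \<cdot> (x4 \<cdot> (x5 \<cdot> x6)))))]"

definition arity7_c :: lincomb where
  "arity7_c =
    [(1, (x0 \<cdot> ((x1 \<cdot> x2) \<cdot> (x3 \<cdot> (x4 \<cdot> x5)))) \<cdot> x6),
     (-1, (x0 \<cdot> x1) \<cdot> (((x2 \<cdot> x3) \<cdot> x4) \<cdot> (x5 \<cdot> x6)))]"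

definition arity7_d :: lincomb where
  "arity7_d =
    [(1, (x0 \<cdot> (x1 \<cdot> (x2 \<cdot> (x3 \<cdot> (x4 \<cdot> x5))))) \<cdot> x6),
     (-1, (x0 \<cdot> x1) \<cdot> ((((x2 \<cdot> x3) \<cdot> x4) \<cdot> x5) \<cdot> x6))]"

definition arity7_e :: lincomb where
  "arity7_e =
    [(1, (x0 \<cdot> (x1 \<cdot> x2)) \<cdot> ((x3 \<cdot> x4) \<cdot> (x5 \<cdot> x6))),
     (-1, x0 \<cdot> ((x1 \<cdot> x2) \<cdot> (x3 \<cdot> (x4 \<cdot> (x5 \<cdot> x6)))))]"

definition arity7_f :: lincomb where
  "arity7_f =
    [(1, (((x0 \<cdot> x1) \<cdot> x2) \<cdot> (x3 \<cdot> (x4 \<cdot> x5))) \<cdot> x6),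
     (-1, (x0 \<cdot> x1) \<cdot> ((x2 \<cdot> x3) \<cdot> ((x4 \<cdot> x5) \<cdot> x6)))]"

definition right_comb_8 :: lincomb where
  "right_comb_8 =
    [(1, x0 \<cdot> (x1 \<cdot> (x2 \<cdot> (x3 \<cdot> (x4 \<cdot> (x5 \<cdot> (x6 \<cdot> x7)))))))]"

section \<open>Verification of the identities by explicit certificates\<close>

context w4_algebra
begin

lemma is_identity_w4: "is_identity w4_identity"
  using satisfies_w4
  by (simp add: is_identity_def w4_identity_def satisfies_w4_iff add.assoc)

text \<open>The summands are the six consequences of w4 in arity five: four with a product in place
  of a letter and two with an outer factor. Here and below \<open>code_simp\<close> checks the
  cancellation of trees, and \<open>simp\<close> supplies the sources.\<close>

lemma is_identity_arity5_a: "is_identity arity5_a"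
  by (rule is_identityI[where k = 1 and cert =
    "[(1, Inst w4_identity [x0, x1, x2, x3 \<cdot> x4]),
     (-1, Inst w4_identity [x0, x1, x2 \<cdot> x3, x4]),
     (-1, Inst w4_identity [x0, x1 \<cdot> x2, x3, x4]),
     (-1, Inst w4_identity [x0 \<cdot> x1, x2, x3, x4]),
     (1, Left_mult x0 (Inst w4_identity [x1, x2, x3, x4])),
     (1, Right_mult (Inst w4_identity [x0, x1, x2, x3]) x4)]"],
     code_simp, simp add: is_identity_w4)

lemma is_identity_arity5_b: "is_identity arity5_b"
  by (rule is_identityI[where k = 1 and cert =
    "[(1, Inst w4_identity [x0, x1, x2, x3 \<cdot> x4]),
     (-1, Inst w4_identity [x0, x1 \<cdot> x2, x3, x4]),
     (-1, Inst w4_identity [x0 \<cdot> x1, x2, x3, x4]),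
     (1, Right_mult (Inst w4_identity [x0, x1, x2, x3]) x4)]"],
     code_simp, simp add: is_identity_w4)

lemma is_identity_arity5_c: "is_identity arity5_c"
  by (rule is_identityI[where k = 1 and cert =
    "[(-1, Inst w4_identity [x0, x1, x2 \<cdot> x3, x4]),
     (-1, Inst w4_identity [x0, x1 \<cdot> x2, x3, x4]),
     (1, Left_mult x0 (Inst w4_identity [x1, x2, x3, x4])),
     (1, Right_mult (Inst w4_identity [x0, x1, x2, x3]) x4)]"],
     code_simp, simp add: is_identity_w4)

lemma is_identity_arity5_d: "is_identity arity5_d"
  by (rule is_identityI[where k = 1 and cert =
    "[(-1, Inst w4_identity [x0, x1, x2, x3 \<cdot> x4]),
     (-1, Inst w4_identity [x0, x1, x2 \<cdot> x3, x4]),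
     (1, Inst w4_identity [x0, x1 \<cdot> x2, x3, x4]),
     (1, Inst w4_identity [x0 \<cdot> x1, x2, x3, x4]),
     (1, Left_mult x0 (Inst w4_identity [x1, x2, x3, x4])),
     (-1, Right_mult (Inst w4_identity [x0, x1, x2, x3]) x4)]"],
     code_simp, simp add: is_identity_w4)

lemma is_identity_arity5_e: "is_identity arity5_e"
  by (rule is_identityI[where k = 1 and cert =
    "[(1, Inst w4_identity [x0, x1, x2, x3 \<cdot> x4]),
     (1, Inst w4_identity [x0, x1, x2 \<cdot> x3, x4]),
     (1, Inst w4_identity [x0, x1 \<cdot> x2, x3, x4]),
     (-1, Inst w4_identity [x0 \<cdot> x1, x2, x3, x4]),
     (-1, Left_mult x0 (Inst w4_identity [x1, x2, x3, x4])),
     (-1, Right_mult (Inst w4_identity [x0, x1, x2, x3]) x4)]"],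
     code_simp, simp add: is_identity_w4)

lemma is_identity_arity5_f: "is_identity arity5_f"
  by (rule is_identityI[where k = 1 and cert =
    "[(-1, Inst w4_identity [x0, x1, x2, x3 \<cdot> x4]),
     (-1, Inst w4_identity [x0, x1, x2 \<cdot> x3, x4]),
     (1, Inst w4_identity [x0 \<cdot> x1, x2, x3, x4]),
     (1, Left_mult x0 (Inst w4_identity [x1, x2, x3, x4]))]"],
     code_simp, simp add: is_identity_w4)

text \<open>This is the base identity of arity six, where a division by 5 occurs. The others follow
  from it and arity five with integer coefficients.\<close>

lemma is_identity_arity6_a: "is_identity arity6_a"
  by (rule is_identityI[where k = 5 and cert =
    "[(-2, Inst arity5_a [x0, x1 \<cdot> x2, x3, x4, x5]),
     (3, Inst arity5_a [x0, x1, x2, x3, x4 \<cdot> x5]),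
     (2, Left_mult x0 (Inst arity5_a [x1, x2, x3, x4, x5])),
     (-2, Inst arity5_c [x0, x1, x2 \<cdot> x3, x4, x5]),
     (-1, Inst arity5_d [x0 \<cdot> x1, x2, x3, x4, x5]),
     (1, Inst arity5_d [x0, x1, x2, x3, x4 \<cdot> x5]),
     (2, Inst arity5_e [x0 \<cdot> x1, x2, x3, x4, x5]),
     (2, Inst arity5_e [x0, x1, x2, x3 \<cdot> x4, x5]),
     (-2, Right_mult (Inst arity5_e [x0, x1, x2, x3, x4]) x5),
     (2, Inst w4_identity [x0, x1 \<cdot> x2, x3 \<cdot> x4, x5])]"],
     code_simp, simp add: is_identity_arity5_a is_identity_arity5_c is_identity_arity5_d is_identity_arity5_e is_identity_w4)

lemma is_identity_arity6_b: "is_identity arity6_b"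
  by (rule is_identityI[where k = 1 and cert =
    "[(1, Inst arity5_d [x0 \<cdot> x1, x2, x3, x4, x5]),
     (-1, Inst arity5_e [x0, x1, x2, x3 \<cdot> x4, x5]),
     (1, Inst arity6_a [x0, x1, x2, x3, x4, x5])]"],
     code_simp, simp add: is_identity_arity5_d is_identity_arity5_e is_identity_arity6_a)

lemma is_identity_arity6_c: "is_identity arity6_c"
  by (rule is_identityI[where k = 1 and cert =
    "[(1, Left_mult x0 (Inst arity5_a [x1, x2, x3, x4, x5])),
     (-1, Inst arity5_d [x0 \<cdot> x1, x2, x3, x4, x5]),
     (1, Inst arity5_d [x0, x1, x2, x3 \<cdot> x4, x5]),
     (1, Inst arity5_e [x0, x1, x2, x3 \<cdot> x4, x5]),
     (-1, Inst arity6_a [x0, x1, x2, x3, x4, x5])]"],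
     code_simp, simp add: is_identity_arity5_a is_identity_arity5_d is_identity_arity5_e is_identity_arity6_a)

lemma is_identity_arity6_d: "is_identity arity6_d"
  by (rule is_identityI[where k = 1 and cert =
    "[(1, Inst arity5_a [x0, x1, x2, x3, x4 \<cdot> x5]),
     (1, Inst arity5_e [x0 \<cdot> x1, x2, x3, x4, x5]),
     (-1, Inst arity6_a [x0, x1, x2, x3, x4, x5])]"],
     code_simp, simp add: is_identity_arity5_a is_identity_arity5_e is_identity_arity6_a)

lemma is_identity_arity6_e: "is_identity arity6_e"
  by (rule is_identityI[where k = 1 and cert =
    "[(-1, Inst arity5_a [x0, x1, x2 \<cdot> x3, x4, x5]),
     (1, Left_mult x0 (Inst arity5_a [x1, x2, x3, x4, x5])),
     (-1, Inst arity5_d [x0 \<cdot> x1, x2, x3, x4, x5]),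
     (1, Inst arity5_d [x0, x1, x2, x3 \<cdot> x4, x5]),
     (1, Inst arity5_e [x0, x1, x2, x3 \<cdot> x4, x5]),
     (1, Left_mult x0 (Inst arity5_e [x1, x2, x3, x4, x5])),
     (-1, Inst arity6_a [x0, x1, x2, x3, x4, x5])]"],
     code_simp, simp add: is_identity_arity5_a is_identity_arity5_d is_identity_arity5_e is_identity_arity6_a)

lemma is_identity_arity6_f: "is_identity arity6_f"
  by (rule is_identityI[where k = 1 and cert =
    "[(-1, Inst arity5_a [x0, x1 \<cdot> x2, x3, x4, x5]),
     (1, Inst arity5_a [x0, x1, x2, x3, x4 \<cdot> x5]),
     (1, Inst arity5_d [x0, x1, x2, x3, x4 \<cdot> x5]),
     (1, Inst arity5_e [x0 \<cdot> x1, x2, x3, x4, x5]),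
     (-1, Inst arity6_a [x0, x1, x2, x3, x4, x5])]"],
     code_simp, simp add: is_identity_arity5_a is_identity_arity5_d is_identity_arity5_e is_identity_arity6_a)

lemma is_identity_arity6_g: "is_identity arity6_g"
  by (rule is_identityI[where k = 1 and cert =
    "[(1, Inst arity5_a [x0, x1 \<cdot> x2, x3, x4, x5]),
     (-1, Inst arity5_a [x0, x1, x2, x3, x4 \<cdot> x5]),
     (1, Inst arity5_d [x0, x1 \<cdot> x2, x3, x4, x5]),
     (-1, Inst arity5_d [x0, x1, x2, x3, x4 \<cdot> x5]),
     (-1, Inst arity5_e [x0 \<cdot> x1, x2, x3, x4, x5]),
     (1, Right_mult (Inst arity5_e [x0, x1, x2, x3, x4]) x5),
     (1, Inst arity6_a [x0, x1, x2, x3, x4, x5])]"],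
     code_simp, simp add: is_identity_arity5_a is_identity_arity5_d is_identity_arity5_e is_identity_arity6_a)

lemma is_identity_arity7_a: "is_identity arity7_a"
  by (rule is_identityI[where k = 4 and cert =
    "[(-2, Inst arity5_a [x0, x1 \<cdot> x2, x3 \<cdot> x4, x5, x6]),
     (-2, Left_mult x0 (Inst arity5_a [x1, x2, x3, x4, x5 \<cdot> x6])),
     (-2, Right_mult (Inst arity5_e [x0 \<cdot> x1, x2, x3, x4, x5]) x6),
     (-2, Inst arity5_e [x0, x1, x2 \<cdot> x3, x4 \<cdot> x5, x6]),
     (2, Inst arity6_a [x0, x1, x2 \<cdot> x3, x4, x5, x6]),
     (-1, Inst arity6_c [x0, x1, x2, x3, x4, x5 \<cdot> x6]),
     (-1, Left_mult x0 (Inst arity6_d [x1, x2, x3, x4, x5, x6])),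
     (2, Right_mult (Inst arity6_d [x0, x1, x2, x3, x4, x5]) x6),
     (1, Inst arity6_e [x0, x1 \<cdot> x2, x3, x4, x5, x6]),
     (1, Inst arity6_f [x0, x1, x2, x3 \<cdot> x4, x5, x6])]"],
     code_simp, simp add: is_identity_arity5_a is_identity_arity5_e is_identity_arity6_a is_identity_arity6_c is_identity_arity6_d is_identity_arity6_e is_identity_arity6_f)

lemma is_identity_arity7_b: "is_identity arity7_b"
  by (rule is_identityI[where k = 2 and cert =
    "[(2, Inst arity5_d [x0 \<cdot> x1, x2 \<cdot> x3, x4, x5, x6]),
     (2, Right_mult (Inst arity5_e [x0 \<cdot> x1, x2, x3, x4, x5]) x6),
     (-2, Inst arity6_b [x0, x1, x2 \<cdot> x3, x4, x5, x6]),
     (1, Inst arity6_c [x0, x1, x2, x3, x4, x5 \<cdot> x6]),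
     (1, Left_mult x0 (Inst arity6_d [x1, x2, x3, x4, x5, x6])),
     (-2, Right_mult (Inst arity6_d [x0, x1, x2, x3, x4, x5]) x6),
     (-1, Inst arity6_e [x0, x1 \<cdot> x2, x3, x4, x5, x6]),
     (-1, Inst arity6_f [x0, x1, x2, x3 \<cdot> x4, x5, x6])]"],
     code_simp, simp add: is_identity_arity5_d is_identity_arity5_e is_identity_arity6_b is_identity_arity6_c is_identity_arity6_d is_identity_arity6_e is_identity_arity6_f)

lemma is_identity_arity7_c: "is_identity arity7_c"
  by (rule is_identityI[where k = 2 and cert =
    "[(-2, Inst arity5_d [x0, x1, x2, x3 \<cdot> x4, x5 \<cdot> x6]),
     (2, Left_mult x0 (Inst arity5_e [x1 \<cdot> x2, x3, x4, x5, x6])),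
     (-1, Inst arity6_a [x0, x1, x2 \<cdot> x3, x4, x5, x6]),
     (2, Inst arity6_c [x0, x1, x2, x3, x4, x5 \<cdot> x6]),
     (-1, Right_mult (Inst arity6_d [x0, x1, x2, x3, x4, x5]) x6),
     (-2, Inst arity6_e [x0, x1 \<cdot> x2, x3, x4, x5, x6]),
     (1, Inst arity6_f [x0 \<cdot> x1, x2, x3, x4, x5, x6]),
     (1, Inst arity6_g [x0, x1, x2, x3, x4 \<cdot> x5, x6])]"],
     code_simp, simp add: is_identity_arity5_d is_identity_arity5_e is_identity_arity6_a is_identity_arity6_c is_identity_arity6_d is_identity_arity6_e is_identity_arity6_f is_identity_arity6_g)

lemma is_identity_arity7_d: "is_identity arity7_d"
  by (rule is_identityI[where k = 4 and cert =
    "[(2, Right_mult (Inst arity5_a [x0, x1, x2, x3, x4 \<cdot> x5]) x6),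
     (-2, Inst arity5_d [x0 \<cdot> x1, x2 \<cdot> x3, x4, x5, x6]),
     (2, Inst arity5_d [x0, x1, x2, x3 \<cdot> x4, x5 \<cdot> x6]),
     (-2, Left_mult x0 (Inst arity5_e [x1 \<cdot> x2, x3, x4, x5, x6])),
     (1, Inst arity6_a [x0, x1, x2 \<cdot> x3, x4, x5, x6]),
     (-2, Inst arity6_c [x0, x1, x2, x3, x4, x5 \<cdot> x6]),
     (1, Right_mult (Inst arity6_d [x0, x1, x2, x3, x4, x5]) x6),
     (2, Inst arity6_e [x0, x1 \<cdot> x2, x3, x4, x5, x6]),
     (-1, Inst arity6_f [x0 \<cdot> x1, x2, x3, x4, x5, x6]),
     (-1, Inst arity6_g [x0, x1, x2, x3, x4 \<cdot> x5, x6])]"],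
     code_simp, simp add: is_identity_arity5_a is_identity_arity5_d is_identity_arity5_e is_identity_arity6_a is_identity_arity6_c is_identity_arity6_d is_identity_arity6_e is_identity_arity6_f is_identity_arity6_g)

lemma is_identity_arity7_e: "is_identity arity7_e"
  by (rule is_identityI[where k = 8 and cert =
    "[(-2, Inst arity5_a [x0, x1, (x2 \<cdot> x3) \<cdot> x4, x5, x6]),
     (2, Inst arity5_a [x0, x1, x2, x3 \<cdot> x4, x5 \<cdot> x6]),
     (2, Inst arity5_b [x0 \<cdot> x1, x2, x3, x4, x5 \<cdot> x6]),
     (-2, Inst arity5_b [x0, x1 \<cdot> (x2 \<cdot> x3), x4, x5, x6]),
     (-4, Inst arity5_b [x0, x1 \<cdot> x2, x3, x4, x5 \<cdot> x6]),
     (2, Inst arity5_b [x0, x1, x2, x3, (x4 \<cdot> x5) \<cdot> x6]),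
     (-2, Left_mult x0 (Inst arity5_c [x1 \<cdot> x2, x3, x4, x5, x6])),
     (-2, Inst arity5_c [x0, x1 \<cdot> x2, x3 \<cdot> x4, x5, x6]),
     (-2, Left_mult x0 (Inst arity5_c [x1, x2 \<cdot> x3, x4, x5, x6])),
     (-4, Left_mult x0 (Inst arity5_c [x1, x2, x3 \<cdot> x4, x5, x6])),
     (-2, Left_mult x0 (Inst arity5_c [x1, x2, x3, x4 \<cdot> x5, x6])),
     (-2, Left_mult (x0 \<cdot> x1) (Inst arity5_c [x2, x3, x4, x5, x6])),
     (-2, Right_mult (Left_mult x0 (Inst arity5_c [x1, x2, x3, x4, x5])) x6),
     (-2, Left_mult x0 (Inst arity5_d [x1 \<cdot> x2, x3, x4, x5, x6])),
     (2, Inst arity5_d [x0, x1 \<cdot> x2, x3 \<cdot> x4, x5, x6]),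
     (1, Right_mult (Inst arity5_d [x0, x1 \<cdot> x2, x3, x4, x5]) x6),
     (-2, Inst arity5_d [x0, x1, x2, x3 \<cdot> (x4 \<cdot> x5), x6]),
     (2, Left_mult x0 (Inst arity5_d [x1, x2, x3, x4, x5 \<cdot> x6])),
     (2, Inst arity5_e [(x0 \<cdot> x1) \<cdot> x2, x3, x4, x5, x6]),
     (1, Inst arity5_e [x0 \<cdot> x1, x2, x3 \<cdot> x4, x5, x6]),
     (-4, Right_mult (Inst arity5_e [x0 \<cdot> x1, x2, x3, x4, x5]) x6),
     (-4, Inst arity5_e [x0, x1, x2 \<cdot> x3, x4 \<cdot> x5, x6]),
     (2, Inst arity5_e [x0, x1, x2, x3 \<cdot> x4, x5 \<cdot> x6]),
     (1, Right_mult (Inst arity5_e [x0, x1, x2, x3 \<cdot> x4, x5]) x6),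
     (1, Left_mult x0 (Inst arity5_e [x1, x2, x3, x4, x5 \<cdot> x6])),
     (2, Right_mult (Right_mult (Inst arity5_e [x0, x1, x2, x3, x4]) x5) x6),
     (-1, Inst arity6_b [x0, x1 \<cdot> x2, x3, x4, x5, x6]),
     (-1, Right_mult (Inst arity6_b [x0, x1, x2, x3, x4, x5]) x6),
     (-1, Inst arity6_c [x0, x1, x2, x3, x4, x5 \<cdot> x6]),
     (-1, Inst arity6_d [x0, x1, x2 \<cdot> x3, x4, x5, x6]),
     (1, Inst arity6_e [x0 \<cdot> x1, x2, x3, x4, x5, x6]),
     (1, Inst arity6_e [x0, x1, x2, x3, x4, x5 \<cdot> x6]),
     (-1, Inst arity6_f [x0, x1, x2, x3, x4 \<cdot> x5, x6]),
     (1, Inst arity6_g [x0, x1 \<cdot> x2, x3, x4, x5, x6])]"],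
     code_simp, simp add: is_identity_arity5_a is_identity_arity5_b is_identity_arity5_c is_identity_arity5_d is_identity_arity5_e is_identity_arity6_b is_identity_arity6_c is_identity_arity6_d is_identity_arity6_e is_identity_arity6_f is_identity_arity6_g)

lemma is_identity_arity7_f: "is_identity arity7_f"
  by (rule is_identityI[where k = 4 and cert =
    "[(-1, Left_mult x0 (Left_mult x1 (Inst arity5_a [x2, x3, x4, x5, x6]))),
     (2, Left_mult x0 (Inst arity5_b [x1 \<cdot> x2, x3, x4, x5, x6])),
     (-4, Right_mult (Inst arity5_c [x0, x1, x2 \<cdot> x3, x4, x5]) x6),
     (2, Inst arity5_c [x0, x1, x2, x3 \<cdot> x4, x5 \<cdot> x6]),
     (-2, Inst arity5_c [x0, x1, x2, x3, x4 \<cdot> (x5 \<cdot> x6)]),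
     (-2, Right_mult (Inst arity5_c [x0, x1, x2, x3, x4]) (x5 \<cdot> x6)),
     (-2, Left_mult x0 (Right_mult (Inst arity5_c [x1, x2, x3, x4, x5]) x6)),
     (-2, Inst arity5_d [x0 \<cdot> x1, x2, x3, x4 \<cdot> x5, x6]),
     (1, Inst arity5_d [x0, (x1 \<cdot> x2) \<cdot> x3, x4, x5, x6]),
     (1, Inst arity5_d [x0, x1 \<cdot> x2, x3 \<cdot> x4, x5, x6]),
     (1, Left_mult x0 (Inst arity5_d [x1, x2, x3, x4, x5 \<cdot> x6])),
     (-2, Inst arity5_e [x0 \<cdot> x1, x2, x3, x4 \<cdot> x5, x6]),
     (1, Inst arity5_e [x0, x1 \<cdot> x2, x3 \<cdot> x4, x5, x6]),
     (1, Inst arity5_e [x0, x1, x2 \<cdot> (x3 \<cdot> x4), x5, x6]),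
     (-1, Inst arity5_e [x0, x1, x2, x3, x4 \<cdot> (x5 \<cdot> x6)]),
     (1, Left_mult x0 (Inst arity5_e [x1, x2, x3, x4, x5 \<cdot> x6])),
     (2, Inst arity5_f [x0 \<cdot> (x1 \<cdot> x2), x3, x4, x5, x6]),
     (-2, Inst arity5_f [x0, x1, x2, (x3 \<cdot> x4) \<cdot> x5, x6]),
     (-2, Right_mult (Inst arity6_b [x0, x1, x2, x3, x4, x5]) x6),
     (-2, Inst arity6_c [x0, x1, x2 \<cdot> x3, x4, x5, x6]),
     (-2, Inst arity6_c [x0, x1, x2, x3, x4 \<cdot> x5, x6]),
     (-1, Left_mult x0 (Inst arity6_c [x1, x2, x3, x4, x5, x6])),
     (-2, Inst arity6_d [x0 \<cdot> x1, x2, x3, x4, x5, x6]),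
     (-2, Inst arity6_d [x0, x1, x2 \<cdot> x3, x4, x5, x6]),
     (-1, Inst arity6_d [x0, x1, x2, x3, x4, x5 \<cdot> x6]),
     (2, Inst arity6_e [x0 \<cdot> x1, x2, x3, x4, x5, x6]),
     (1, Inst arity6_e [x0, x1, x2, x3 \<cdot> x4, x5, x6]),
     (1, Inst arity6_f [x0, x1 \<cdot> x2, x3, x4, x5, x6]),
     (2, Inst arity6_f [x0, x1, x2, x3, x4 \<cdot> x5, x6]),
     (2, Right_mult (Inst arity6_f [x0, x1, x2, x3, x4, x5]) x6),
     (-4, Inst arity7_a [x0, x1, x2, x3, x4, x5, x6]),
     (2, Inst arity7_b [x0, x1, x2, x3, x4, x5, x6])]"],
     code_simp, simp add: is_identity_arity5_a is_identity_arity5_b is_identity_arity5_c is_identity_arity5_d is_identity_arity5_e is_identity_arity5_f is_identity_arity6_b is_identity_arity6_c is_identity_arity6_d is_identity_arity6_e is_identity_arity6_f is_identity_arity7_a is_identity_arity7_b)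

text \<open>Every bracketing other than the right comb cancels in this combination, and the right
  comb remains with coefficient 2.\<close>

lemma is_identity_right_comb_8: "is_identity right_comb_8"
  by (rule is_identityI[where k = 2 and cert =
    "[(2, Inst arity7_c [x0, x1 \<cdot> x2, x3, x4, x5, x6, x7]),
     (4, Inst arity7_e [x0, x1, x2, x3 \<cdot> x4, x5, x6, x7]),
     (-2, Inst arity7_b [x0, x1 \<cdot> x2, x3, x4, x5, x6, x7]),
     (-4, Inst arity7_e [x0, x1, x2, x3, x4, x5 \<cdot> x6, x7]),
     (-2, Inst arity5_a [x0, x1 \<cdot> x2, x3, x4, (x5 \<cdot> x6) \<cdot> x7]),
     (4, Inst arity7_c [x0, x1, x2, x3, x4, x5, x6 \<cdot> x7]),
     (-4, Inst arity7_b [x0, x1, x2, x3, x4, x5, x6 \<cdot> x7]),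
     (-4, Right_mult (Inst arity5_c [x0, x1 \<cdot> x2, x3, x4, x5]) (x6 \<cdot> x7)),
     (2, Inst arity5_d [x0, x1 \<cdot> x2, x3, x4, x5 \<cdot> (x6 \<cdot> x7)]),
     (4, Inst arity6_e [x0, x1, x2, x3, x4, x5 \<cdot> (x6 \<cdot> x7)]),
     (-4, Inst arity5_a [x0, x1, x2 \<cdot> x3, x4, x5 \<cdot> (x6 \<cdot> x7)]),
     (4, Right_mult (Inst arity5_a [x0, x1, x2, x3, x4]) (x5 \<cdot> (x6 \<cdot> x7))),
     (4, Inst arity5_c [x0, x1, x2 \<cdot> x3, x4, x5 \<cdot> (x6 \<cdot> x7)]),
     (-2, Inst arity6_d [x0, x1 \<cdot> x2, x3, x4, x5, x6 \<cdot> x7]),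
     (-10, Inst arity7_e [x0, x1, x2, x3, x4, x5, x6 \<cdot> x7]),
     (-4, Inst arity5_a [x0, x1 \<cdot> x2, x3, x4, x5 \<cdot> (x6 \<cdot> x7)]),
     (4, Inst arity7_e [x0, x1 \<cdot> x2, x3, x4, x5, x6, x7]),
     (2, Inst arity5_a [x0, (x1 \<cdot> x2) \<cdot> x3, x4, x5, x6 \<cdot> x7]),
     (2, Inst arity5_f [x0 \<cdot> ((x1 \<cdot> x2) \<cdot> x3), x4, x5, x6, x7]),
     (-4, Inst arity7_b [x0, x1, x2, x3, x4, x5 \<cdot> x6, x7]),
     (3, Inst arity7_c [x0, x1, x2, x3, x4, x5 \<cdot> x6, x7]),
     (2, Inst arity6_a [x0, (x1 \<cdot> x2) \<cdot> x3, x4, x5, x6, x7]),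
     (-2, Inst arity5_d [x0 \<cdot> ((x1 \<cdot> x2) \<cdot> x3), x4, x5, x6, x7]),
     (-4, Right_mult (Inst arity5_f [x0, x1, x2, x3, x4]) ((x5 \<cdot> x6) \<cdot> x7)),
     (2, Inst arity6_f [x0, x1, x2, x3, x4, (x5 \<cdot> x6) \<cdot> x7]),
     (-4, Right_mult (Inst arity5_e [x0, x1, x2, x3, x4]) ((x5 \<cdot> x6) \<cdot> x7)),
     (-2, Right_mult (Right_mult (Inst arity5_f [x0, x1, x2, x3, x4]) (x5 \<cdot> x6)) x7),
     (-4, Inst arity5_c [x0, x1, x2 \<cdot> x3, x4, (x5 \<cdot> x6) \<cdot> x7]),
     (2, Inst arity5_a [x0 \<cdot> (x1 \<cdot> (x2 \<cdot> x3)), x4, x5, x6, x7]),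
     (2, Inst arity6_a [x0, x1 \<cdot> x2, x3 \<cdot> x4, x5, x6, x7]),
     (2, Right_mult (Inst arity7_e [x0, x1, x2, x3, x4, x5, x6]) x7),
     (-2, Inst arity7_e [x0, x1, x2 \<cdot> x3, x4, x5, x6, x7]),
     (2, Left_mult x0 (Inst arity5_c [x1, x2, x3, x4, x5 \<cdot> (x6 \<cdot> x7)])),
     (1, Inst arity7_f [x0, x1, x2 \<cdot> x3, x4, x5, x6, x7]),
     (-1, Right_mult (Inst arity6_d [x0, x1, x2, x3, x4, x5 \<cdot> x6]) x7),
     (-2, Right_mult (Inst arity5_c [x0, (x1 \<cdot> x2) \<cdot> x3, x4, x5, x6]) x7),
     (-2, Inst arity7_d [x0, x1 \<cdot> x2, x3, x4, x5, x6, x7]),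
     (2, Inst arity5_b [x0 \<cdot> (x1 \<cdot> x2), x3 \<cdot> x4, x5, x6, x7]),
     (2, Inst arity7_a [x0, x1 \<cdot> x2, x3, x4, x5, x6, x7]),
     (2, Right_mult (Inst arity5_c [x0, x1 \<cdot> x2, x3, x4, x5 \<cdot> x6]) x7),
     (-2, Inst arity5_f [x0 \<cdot> (x1 \<cdot> x2), x3, x4, x5 \<cdot> x6, x7]),
     (1, Inst arity7_f [x0, x1 \<cdot> x2, x3, x4, x5, x6, x7]),
     (1, Inst arity5_d [x0 \<cdot> (x1 \<cdot> x2), x3, x4, x5 \<cdot> x6, x7])]"],
     code_simp, simp add: is_identity_arity5_a is_identity_arity5_b is_identity_arity5_c is_identity_arity5_d is_identity_arity5_e is_identity_arity5_f is_identity_arity6_a is_identity_arity6_d is_identity_arity6_e is_identity_arity6_f is_identity_arity7_a is_identity_arity7_b is_identity_arity7_c is_identity_arity7_d is_identity_arity7_e is_identity_arity7_f)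

lemma iterated_annihilator_7: "iterated_annihilator mul 7 = UNIV"
proof -
  \<comment> \<open>Eight letters are seven left factors and one argument, which is why the index is
    7.\<close>
  have "mul a (mul b (mul c (mul d (mul e (mul f (mul g h)))))) = 0" for a b c d e f g h
    using is_identity_right_comb_8[unfolded is_identity_def, rule_format, of "(!) [a, b, c, d, e, f, g, h]"]
    by (simp add: right_comb_8_def)
  then show ?thesis
    by (auto simp: eval_nat_numeral)
qed

end

section \<open>Examples\<close>

lemma vector_space_smult: "vector_space (smult :: 'k::field \<Rightarrow> 'k poly \<Rightarrow> 'k poly)"
  by unfold_locales (simp_all add: smult_add_right smult_add_left)

lemma nonassoc_algebra_smultI:
  assumes "\<And>a b c. mul (a + b) c = mul a c + mul b c" "\<And>a b c. mul a (b + c) = mul a b + mul a c"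
    and "\<And>k a b. mul (smult k a) b = smult k (mul a b)" "\<And>k a b. mul a (smult k b) = smult k (mul a b)"
  shows "nonassoc_algebra (smult :: 'k::field \<Rightarrow> 'k poly \<Rightarrow> 'k poly) mul"
proof -
  interpret vector_space "smult :: 'k \<Rightarrow> 'k poly \<Rightarrow> 'k poly" by (rule vector_space_smult)
  show ?thesis
    by unfold_locales (simp_all add: assms)
qed

text \<open>The monomial x^0 is the generator e, and x^1, x^2, x^3 span the bimodule M; higher
  monomials multiply to zero. Left action of e is e12 - e23: it sends x^2 to x^1 and x^3 to -x^2.
  Right action is e21 + e32: it sends x^1 to x^2 and x^2 to x^3.\<close>

definition alternating_mul :: "'k::field poly \<Rightarrow> 'k poly \<Rightarrow> 'k poly" where
  "alternating_mul p q =
    [:0, coeff p 0 * coeff q 2,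
      coeff q 0 * coeff p 1 - coeff p 0 * coeff q 3,
      coeff q 0 * coeff p 2:]"

lemma nonassoc_algebra_alternating:
  "nonassoc_algebra (smult :: 'k::field \<Rightarrow> 'k poly \<Rightarrow> 'k poly) alternating_mul"
  by (rule nonassoc_algebra_smultI) (simp_all add: alternating_mul_def algebra_simps)

lemma satisfies_w4_alternating: "satisfies_w (alternating_mul :: 'k::field poly \<Rightarrow> _) 4"
  by (simp add: nonassoc_algebra.satisfies_w4_iff[OF nonassoc_algebra_alternating]
      alternating_mul_def numeral_2_eq_2 numeral_3_eq_3 algebra_simps)

text \<open>Right multiplication by e takes x^1 to x^2 and left multiplication takes x^2 back to
  x^1, so alternating words of any length do not kill x^1.\<close>

lemma U_alg_alternating:
  assumes "N \<ge> 1"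
  shows "end_power smult (U_alg smult (alternating_mul :: 'k::field poly \<Rightarrow> _)) N \<noteq> {0}"
proof -
  let ?l = "alternating_mul [:1::'k:]" and ?r = "\<lambda>x. alternating_mul x [:1::'k:]"
  \<comment> \<open>The image is x^1 or x^2 according to the parity of N, so the induction carries
    both possibilities.\<close>
  have "\<exists>fs. length fs = N \<and> set fs \<subseteq> {?l, ?r} \<and> foldr (\<circ>) fs id [:0, 1:] \<in> {[:0, 1:], [:0, 0, 1:]}"
  proof (induction N)
    case (Suc N)
    then obtain fs where fs: "length fs = N" "set fs \<subseteq> {?l, ?r}"
      "foldr (\<circ>) fs id [:0, 1:] \<in> {[:0, 1:], [:0, 0, 1:]}" by blast
    have "?l [:0, 0, 1:] = [:0, 1:]" "?r [:0, 1:] = [:0, 0, 1:]"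
      by (simp_all add: alternating_mul_def numeral_2_eq_2 numeral_3_eq_3)
    with fs(3) have "\<exists>f\<in>{?l, ?r}. f (foldr (\<circ>) fs id [:0, 1:]) \<in> {[:0, 1:], [:0, 0, 1:]}"
      by auto
    then obtain f where "f \<in> {?l, ?r}" "f (foldr (\<circ>) fs id [:0, 1:]) \<in> {[:0, 1:], [:0, 0, 1:]}"
      by blast
    then have "foldr (\<circ>) (f # fs) id [:0, 1:] \<in> {[:0, 1:], [:0, 0, 1:]}"
      by (simp only: foldr_comp_Cons)
    with fs \<open>f \<in> {?l, ?r}\<close> show ?case
      by (intro exI[of _ "f # fs"] conjI) (simp_all only: length_Cons list.set insert_subset simp_thms)
  qed auto
  then obtain fs where fs: "length fs = N" "set fs \<subseteq> {?l, ?r}"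
    "foldr (\<circ>) fs id [:0, 1:] \<in> {[:0, 1:], [:0, 0, 1:]}" by blast
  have "set fs \<subseteq> U_alg smult (alternating_mul :: 'k poly \<Rightarrow> _)"
    using fs(2) unfolding U_alg_def by (auto intro!: hull_end_subalgebra_superset)
  with fs show ?thesis
    by (intro end_power_nonzero[OF vector_space_smult fs(1), where x = "[:0, 1:]"]) auto
qed

text \<open>The monomials $x^0, \dots, x^{14}$ are a homogeneous basis of the truncated quotient: $x^0$ is
  the generator, the degrees two to seven begin at $x^1, x^2, x^4, x^8, x^{12}, x^{14}$, and
  $x^{14}$ is the right comb.\<close>

definition nilpotent_mul :: "'k::field_char_0 poly \<Rightarrow> 'k poly \<Rightarrow> 'k poly" where
  "nilpotent_mul p q =
    (let a = coeff p; b = coeff q in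
     [:0,
       a 0 * b 0,
       a 0 * b 1,
       a 1 * b 0,
       a 0 * b 2 - a 3 * b 0,
       a 0 * b 3 - a 3 * b 0,
       a 1 * b 1 - a 3 * b 0,
       a 2 * b 0 - a 3 * b 0,
       a 0 * b 4 - a 0 * b 6 - a 4 * b 0 + a 6 * b 0 + a 7 * b 0,
       a 0 * b 5 - a 4 * b 0 + a 7 * b 0,
       a 0 * b 7 - a 4 * b 0 + a 7 * b 0,
       a 5 * b 0 - a 7 * b 0,
       a 0 * b 8 - a 1 * b 4 + 2 * (a 1 * b 6) + a 4 * b 1 - 2 * (a 6 * b 1) + a 8 * b 0 + a 9 * b 0 + 2 * (a 11 * b 0),
       a 0 * b 9 + a 0 * b 10 - a 1 * b 5 + a 1 * b 7 + a 5 * b 1 - a 7 * b 1 + 2 * (a 9 * b 0) - 2 * (a 10 * b 0) - a 11 * b 0,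
       a 0 * b 12 - a 1 * b 11 - a 2 * b 6 - a 4 * b 2 + a 5 * b 3 + a 6 * b 2 + a 7 * b 2 - a 7 * b 3 - a 8 * b 1 - a 11 * b 1 - a 13 * b 0:])"

lemma nonassoc_algebra_nilpotent:
  "nonassoc_algebra (smult :: 'k::field_char_0 \<Rightarrow> 'k poly \<Rightarrow> 'k poly) nilpotent_mul"
  by (rule nonassoc_algebra_smultI) (simp_all add: nilpotent_mul_def Let_def algebra_simps)

text \<open>With the coefficients of four arbitrary arguments as unknowns, each coordinate of w4 is
  a polynomial whose terms cancel after expansion.\<close>

lemma satisfies_w4_nilpotent: "satisfies_w (nilpotent_mul :: 'k::field_char_0 poly \<Rightarrow> _) 4"
  unfolding nonassoc_algebra.satisfies_w4_iff[OF nonassoc_algebra_nilpotent]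
  by (simp add: nilpotent_mul_def Let_def coeff_pCons eval_nat_numeral algebra_simps)

lemma L_alg_nilpotent:
  "end_power smult (L_alg smult (nilpotent_mul :: 'k::field_char_0 poly \<Rightarrow> _)) 6 \<noteq> {0}"
proof (rule end_power_nonzero[OF vector_space_smult])
  show "length (replicate 6 (nilpotent_mul [:1 :: 'k:])) = 6"
    by simp
  show "set (replicate 6 (nilpotent_mul [:1 :: 'k:])) \<subseteq> L_alg smult nilpotent_mul"
    by (auto simp: L_alg_def intro!: hull_end_subalgebra_superset)
  \<comment> \<open>Repeated left multiplication by x^0 runs through x^0, x^1, x^2, x^4, x^8, x^12,
    x^14, one degree at a time.\<close>
  show "foldr (\<circ>) (replicate 6 (nilpotent_mul [:1 :: 'k:])) id [:1:] \<noteq> 0"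
    by (simp add: nilpotent_mul_def Let_def coeff_pCons eval_nat_numeral)
qed

section \<open>Both parts of the theorem, with right multiplications treated in the opposite
  algebra\<close>

theorem theorem1:
  shows
    "(\<forall>(scale :: 'k::field_char_0 \<Rightarrow> 'a::ab_group_add \<Rightarrow> 'a) mul.
        nonassoc_algebra scale mul \<longrightarrow> satisfies_w mul 4 \<longrightarrow>
          end_power scale (L_alg scale mul) 7 = {0} \<and>
          end_power scale (R_alg scale mul) 7 = {0}) \<and>
     (\<exists>(scale :: 'k \<Rightarrow> 'k poly \<Rightarrow> 'k poly) mul.
        nonassoc_algebra scale mul \<and> satisfies_w mul 4 \<and>
          end_power scale (L_alg scale mul) 6 \<noteq> {0}) \<and>
     (\<exists>(scale :: 'k \<Rightarrow> 'k poly \<Rightarrow> 'k poly) mul.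
        nonassoc_algebra scale mul \<and> satisfies_w mul 4 \<and>
          end_power scale (R_alg scale mul) 6 \<noteq> {0}) \<and>
     (\<exists>(scale :: 'k \<Rightarrow> 'k poly \<Rightarrow> 'k poly) mul.
        nonassoc_algebra scale mul \<and> satisfies_w mul 4 \<and>
          (\<forall>N\<ge>1. end_power scale (U_alg scale mul) N \<noteq> {0}))"
proof (intro conjI)
  show "\<forall>(scale :: 'k \<Rightarrow> 'a \<Rightarrow> 'a) mul. nonassoc_algebra scale mul \<longrightarrow> satisfies_w mul 4 \<longrightarrow>
      end_power scale (L_alg scale mul) 7 = {0} \<and> end_power scale (R_alg scale mul) 7 = {0}"
  proof (intro allI impI)
    fix scale :: "'k \<Rightarrow> 'a \<Rightarrow> 'a" and mul
    assume *: "nonassoc_algebra scale mul" "satisfies_w mul 4"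
    interpret w4_algebra scale mul
      using * by (simp add: w4_algebra_def w4_algebra_axioms_def)
    interpret opp: w4_algebra scale "\<lambda>x y. mul y x"
      using opposite satisfies_w4_opposite[OF *] by (simp add: w4_algebra_def w4_algebra_axioms_def)
    show "end_power scale (L_alg scale mul) 7 = {0} \<and> end_power scale (R_alg scale mul) 7 = {0}"
      using end_power_L_alg_eq_0[OF iterated_annihilator_7]
        opp.end_power_L_alg_eq_0[OF opp.iterated_annihilator_7]
      by (simp add: L_alg_opposite)
  qed
next
  show "\<exists>(scale :: 'k \<Rightarrow> 'k poly \<Rightarrow> 'k poly) mul. nonassoc_algebra scale mul \<and> satisfies_w mul 4 \<and>
      end_power scale (L_alg scale mul) 6 \<noteq> {0}"
    using nonassoc_algebra_nilpotent satisfies_w4_nilpotent L_alg_nilpotent by blast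
next
  interpret nonassoc_algebra "smult :: 'k \<Rightarrow> _" nilpotent_mul
    by (rule nonassoc_algebra_nilpotent)
  interpret opp: nonassoc_algebra "smult :: 'k \<Rightarrow> _" "\<lambda>x y. nilpotent_mul y x"
    by (rule opposite)
  \<comment> \<open>Taking the opposite twice returns \<open>nilpotent_mul\<close>, so this R(A) is
    the L(A) of the original algebra.\<close>
  have "end_power smult (R_alg smult (\<lambda>x y :: 'k poly. nilpotent_mul y x)) 6 \<noteq> {0}"
    using L_alg_nilpotent by (simp flip: opp.L_alg_opposite)
  then show "\<exists>(scale :: 'k \<Rightarrow> 'k poly \<Rightarrow> 'k poly) mul. nonassoc_algebra scale mul \<and> satisfies_w mul 4 \<and>
      end_power scale (R_alg scale mul) 6 \<noteq> {0}"
    using opposite satisfies_w4_opposite[OF nonassoc_algebra_nilpotent satisfies_w4_nilpotent] by blast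
next
  show "\<exists>(scale :: 'k \<Rightarrow> 'k poly \<Rightarrow> 'k poly) mul. nonassoc_algebra scale mul \<and> satisfies_w mul 4 \<and>
      (\<forall>N\<ge>1. end_power scale (U_alg scale mul) N \<noteq> {0})"
    using nonassoc_algebra_alternating satisfies_w4_alternating U_alg_alternating by blast
qed

end
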